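(* Let $\mathbb{X}$ and $\mathbb{Y}$ be $n$-dimensional polyhedral Banach spaces. If a linear operator $T:\mathbb{X}\to\mathbb{Y}$ preserves Birkhoff-James orthogonality at an extreme point $x$ of the unit ball $B_{\mathbb{X}}$, then $Tx$ is a scalar multiple of some extreme point of the unit ball $B_{\mathbb{Y}}$.
   Context: A finite-dimensional real Banach space is polyhedral if its unit ball has only finitely many extreme points. For $x,y$ in a Banach space, $x\perp_B y$ (Birkhoff-James orthogonality) means $\|x+\lambda y\|\ge\|x\|$ for all scalars $\lambda$. $T$ preserves Birkhoff-James orthogonality at $x\in\mathbb{X}$ if for every $y\in\mathbb{X}$, $x\perp_B y$ implies $Tx\perp_B Ty$. Scalar multiples include the zero multiple. *)

theory Defs
  imports "HOL-Analysis.Analysis"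
begin

definition finite_dimensional :: "'a::real_vector itself \<Rightarrow> bool" where
  "finite_dimensional _ \<longleftrightarrow> (\<exists>B :: 'a set. finite B \<and> span B = UNIV)"

text \<open>The class \<open>banach\<close> is used rather than \<open>euclidean_space\<close>, whose norm always comes from
  an inner product.\<close>

definition polyhedral :: "'a::banach itself \<Rightarrow> bool" where
  "polyhedral _ \<longleftrightarrow>
     finite_dimensional TYPE('a) \<and> finite {e :: 'a. e extreme_point_of cball 0 1}"

definition bj_orthogonal :: "'a::real_normed_vector \<Rightarrow> 'a \<Rightarrow> bool"  (infix "\<bottom>\<^sub>B" 50) where
  "x \<bottom>\<^sub>B y \<longleftrightarrow> (\<forall>c :: real. norm (x + c *\<^sub>R y) \<ge> norm x)"

definition preserves_bj_orthogonality_at ::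
    "('a::real_normed_vector \<Rightarrow> 'b::real_normed_vector) \<Rightarrow> 'a \<Rightarrow> bool" where
  "preserves_bj_orthogonality_at T x \<longleftrightarrow> (\<forall>y. x \<bottom>\<^sub>B y \<longrightarrow> T x \<bottom>\<^sub>B T y)"

end

theory Submission imports Defs
begin

text \<open>
  The idea is to measure how sharp a corner of the unit ball is. For \<open>x\<close> of norm one and any \<open>y\<close>,
  the numbers \<open>c\<close> with \<open>x \<bottom>\<^sub>B y - c *\<^sub>R x\<close> are the values at \<open>y\<close> of the norm-one functionals
  that support the ball at \<open>x\<close>. They form an interval, bounded by the two one-sided derivatives of
  the norm at \<open>x\<close> in direction \<open>y\<close>. The argument only uses these numbers, and so needs no dual space.

  On the domain side, \<open>x\<close> is a vertex of a polytope. The cone of directions that point from a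
  vertex into the polytope is closed and contains no line, and a direction \<open>y\<close> outside the line through \<open>x\<close>
  in which the norm is differentiable at \<open>x\<close> would, after subtraction of a multiple of \<open>x\<close>, give such a line. Hence for
  every \<open>y\<close> outside that line at least two values of \<open>c\<close> occur
  (\<open>extreme_point_two_orthogonal_shifts\<close>).

  On the codomain side, suppose \<open>T x \<noteq> 0\<close>, and let \<open>w\<close> be the normalisation of \<open>T x\<close>. If both
  \<open>w + v\<close> and \<open>w - v\<close> lie in the ball, then \<open>w \<bottom>\<^sub>B v - c *\<^sub>R w\<close> forces \<open>c = 0\<close>
  (\<open>two_sided_direction_unique_orthogonal_shift\<close>). As \<open>T\<close> preserves orthogonality at \<open>x\<close>, it maps
  distinct values of \<open>c\<close> for \<open>u\<close> to distinct values for \<open>T u\<close>, so that \<open>v = T u\<close> is only possible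
  for \<open>u\<close> on the line through \<open>x\<close>. The case \<open>v = 0\<close> shows that \<open>T\<close> is injective, hence surjective
  by equality of dimensions; then every \<open>v\<close> as above is a multiple of \<open>w\<close>, hence zero, and \<open>w\<close> is
  extreme.

  Both the representation of the polyhedral ball as the convex hull of finitely many points and the
  existence of some extreme point in the case \<open>T x = 0\<close> come from Minkowski's theorem in a
  finite-dimensional normed space (\<open>finite_dimensional_convex_hull_extreme_points\<close>).
\<close>

section \<open>Extreme points of closed bounded convex sets\<close>

text \<open>For convex \<open>K\<close> this is the direction space of the smallest face of \<open>K\<close> that contains \<open>x\<close>.\<close>

definition two_sided_directions :: "'a::real_vector set \<Rightarrow> 'a \<Rightarrow> 'a set" where
  "two_sided_directions K x = {d. \<exists>t>0. x + t *\<^sub>R d \<in> K \<and> x - t *\<^sub>R d \<in> K}"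

lemma convex_midsegment_mem:
  assumes "convex K" "x + t *\<^sub>R d \<in> K" "x - t *\<^sub>R d \<in> K" "\<bar>s\<bar> \<le> t"
  shows "x + s *\<^sub>R d \<in> K"
proof (cases "t = 0")
  case True
  then show ?thesis using assms by auto
next
  case False
  define l where "l = (t + s) / (2 * t)"
  have t: "t > 0" using False assms(4) by linarith
  have l: "0 \<le> l" "l \<le> 1" using t assms(4) by (auto simp: l_def divide_simps)
  have "l * t - (1 - l) * t = s" using t by (simp add: l_def field_simps)
  then have "l *\<^sub>R (x + t *\<^sub>R d) + (1 - l) *\<^sub>R (x - t *\<^sub>R d) = x + s *\<^sub>R d"
    by (auto simp: algebra_simps simp flip: scaleR_add_left)
  then show ?thesis using convexD[OF assms(1-3), of l "1 - l"] l by simp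
qed

lemma subspace_two_sided_directions:
  assumes "convex K" "x \<in> K"
  shows "subspace (two_sided_directions K x)"
proof (rule subspaceI)
  show "0 \<in> two_sided_directions K x"
    using assms by (auto simp: two_sided_directions_def intro: exI[of _ 1])
next
  fix d e assume "d \<in> two_sided_directions K x" "e \<in> two_sided_directions K x"
  then obtain s t where st: "s > 0" "t > 0" "x + s *\<^sub>R d \<in> K" "x - s *\<^sub>R d \<in> K"
      "x + t *\<^sub>R e \<in> K" "x - t *\<^sub>R e \<in> K"
    by (auto simp: two_sided_directions_def)
  define r where "r = min s t"
  have r: "r > 0" "\<bar>r\<bar> \<le> s" "\<bar>-r\<bar> \<le> s" "\<bar>r\<bar> \<le> t" "\<bar>-r\<bar> \<le> t" using st by (auto simp: r_def)
  note d = convex_midsegment_mem[OF assms(1) st(3,4)] and e = convex_midsegment_mem[OF assms(1) st(5,6)]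
  have "(1/2) *\<^sub>R (x + r *\<^sub>R d) + (1/2) *\<^sub>R (x + r *\<^sub>R e) = x + (r/2) *\<^sub>R (d + e)"
    "(1/2) *\<^sub>R (x + (-r) *\<^sub>R d) + (1/2) *\<^sub>R (x + (-r) *\<^sub>R e) = x - (r/2) *\<^sub>R (d + e)"
    by (auto simp: algebra_simps simp flip: scaleR_add_left)
  moreover have "(1/2) *\<^sub>R (x + r *\<^sub>R d) + (1/2) *\<^sub>R (x + r *\<^sub>R e) \<in> K"
    using convexD[OF assms(1) d[OF r(2)] e[OF r(4)], of "1/2" "1/2"] by simp
  moreover have "(1/2) *\<^sub>R (x + (-r) *\<^sub>R d) + (1/2) *\<^sub>R (x + (-r) *\<^sub>R e) \<in> K"
    using convexD[OF assms(1) d[OF r(3)] e[OF r(5)], of "1/2" "1/2"] by simp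
  ultimately show "d + e \<in> two_sided_directions K x"
    unfolding two_sided_directions_def using r(1) by (auto intro!: exI[of _ "r/2"])
next
  fix c d assume "d \<in> two_sided_directions K x"
  then obtain t where t: "t > 0" "x + t *\<^sub>R d \<in> K" "x - t *\<^sub>R d \<in> K"
    by (auto simp: two_sided_directions_def)
  define s where "s = t / (\<bar>c\<bar> + 1)"
  have s: "s > 0" "\<bar>s * c\<bar> \<le> t" "\<bar>- (s * c)\<bar> \<le> t"
    using t(1) by (auto simp: s_def abs_mult divide_simps)
  show "c *\<^sub>R d \<in> two_sided_directions K x"
    unfolding two_sided_directions_def
    using s(1) convex_midsegment_mem[OF assms(1) t(2,3) s(2)] convex_midsegment_mem[OF assms(1) t(2,3) s(3)]
    by (auto intro!: exI[of _ s])
qed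

lemma two_sided_direction_of_not_extreme:
  assumes "convex K" "x \<in> K" "\<not> x extreme_point_of K"
  obtains d where "d \<noteq> 0" "x + d \<in> K" "x - d \<in> K"
proof -
  obtain a b where ab: "a \<in> K" "b \<in> K" "x \<in> open_segment a b"
    using assms by (auto simp: extreme_point_of_def)
  then obtain u where u: "0 < u" "u < 1" "x = (1 - u) *\<^sub>R a + u *\<^sub>R b" "a \<noteq> b"
    by (auto simp: in_segment)
  define r where "r = min u (1 - u)"
  have seg: "x + s *\<^sub>R (b - a) \<in> K" if "\<bar>s\<bar> \<le> r" for s
  proof -
    have "x + s *\<^sub>R (b - a) = (1 - (u + s)) *\<^sub>R a + (u + s) *\<^sub>R b"
      by (simp add: u(3) algebra_simps)
    then show ?thesis
      using convexD[OF assms(1) ab(1,2), of "1 - (u + s)" "u + s"] that u by (auto simp: r_def)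
  qed
  have "r > 0" using u by (simp add: r_def)
  show thesis
    by (rule that[of "r *\<^sub>R (b - a)"]) (use seg[of r] seg[of "-r"] \<open>r > 0\<close> u(4) in auto)
qed

lemma dim_psubset_finite_dimensional:
  fixes U V :: "'a::real_vector set"
  assumes "finite_dimensional TYPE('a)" "subspace U" "subspace V" "U \<subset> V"
  shows "dim U < dim V"
proof -
  obtain S :: "'a set" where S: "finite S" "span S = UNIV"
    using assms(1) by (auto simp: finite_dimensional_def)
  obtain v where v: "v \<in> V" "v \<notin> U" using assms(4) by auto
  obtain B where B: "B \<subseteq> U" "independent B" "U \<subseteq> span B" "card B = dim U"
    using basis_exists by blast
  obtain C where C: "C \<subseteq> V" "independent C" "V \<subseteq> span C" "card C = dim V"
    using basis_exists by blast
  have fin: "finite B" "finite C"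
    using independent_span_bound[OF S(1)] B(2) C(2) S(2) by auto
  have "v \<notin> span B" using v(2) B(1) assms(2) by (meson span_minimal subsetD)
  then have "independent (insert v B)" "v \<notin> B"
    using B(2) span_base by (auto simp: independent_insert)
  moreover have "insert v B \<subseteq> span C" using v(1) B(1) C(3) assms(4) by auto
  ultimately have "Suc (card B) \<le> card C"
    using independent_span_bound[OF fin(2), of "insert v B"] fin(1) by auto
  then show ?thesis using B(4) C(4) by simp
qed

text \<open>
  Minkowski's theorem. From a point that is not extreme, travel both ways along a two-sided direction
  until \<open>K\<close> ends. The point is a convex combination of the two exit points, and each of them lies in
  a proper face of the face of the point, so that its space of two-sided directions has smaller
  dimension. Boundedness makes the journey end, and closedness keeps its end in \<open>K\<close>.
\<close>

theorem finite_dimensional_convex_hull_extreme_points: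
  fixes K :: "'a::real_normed_vector set"
  assumes fd: "finite_dimensional TYPE('a)" and K: "convex K" "closed K" "bounded K"
  shows "x \<in> K \<Longrightarrow> x \<in> convex hull {e. e extreme_point_of K}"
proof (induction "dim (two_sided_directions K x)" arbitrary: x rule: less_induct)
  case less
  show ?case
  proof (cases "x extreme_point_of K")
    case True
    then show ?thesis by (simp add: hull_inc)
  next
    case False
    then obtain d where d: "d \<noteq> 0" "x + d \<in> K" "x - d \<in> K"
      using two_sided_direction_of_not_extreme[OF K(1) less.prems] by blast
    have exit_point: "\<exists>s>0. x + s *\<^sub>R d' \<in> K \<and> (\<forall>t>s. x + t *\<^sub>R d' \<notin> K)"
      if d': "d' \<noteq> 0" "x + d' \<in> K" for d'
    proof -
      let ?S = "{s. 1 \<le> s \<and> x + s *\<^sub>R d' \<in> K}"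
      obtain R where R: "\<And>y. y \<in> K \<Longrightarrow> norm y \<le> R" using K(3) by (auto simp: bounded_iff)
      have "bdd_above ?S"
      proof (rule bdd_aboveI)
        fix s assume s: "s \<in> ?S"
        have "s * norm d' = norm ((x + s *\<^sub>R d') - x)" using s by simp
        also have "\<dots> \<le> norm (x + s *\<^sub>R d') + norm x" by (rule norm_triangle_ineq4)
        also have "\<dots> \<le> R + norm x" using R s by simp
        finally show "s \<le> (R + norm x) / norm d'" using d'(1) by (simp add: field_simps)
      qed
      moreover have "closed ?S"
      proof -
        have "?S = {1..} \<inter> (\<lambda>s. x + s *\<^sub>R d') -` K" by auto
        moreover have "closed ((\<lambda>s. x + s *\<^sub>R d') -` K)"
          by (intro closed_vimage K(2) continuous_intros)
        ultimately show ?thesis by auto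
      qed
      moreover have "1 \<in> ?S" using d'(2) by simp
      ultimately have mem: "Sup ?S \<in> ?S" and up: "\<And>s. s \<in> ?S \<Longrightarrow> s \<le> Sup ?S"
        using closed_contains_Sup[of ?S] cSup_upper[of _ ?S] by blast+
      have "x + t *\<^sub>R d' \<notin> K" if "t > Sup ?S" for t
        using up[of t] mem that by auto
      then show ?thesis using mem by (intro exI[of _ "Sup ?S"]) auto
    qed
    obtain s where s: "s > 0" "x + s *\<^sub>R d \<in> K" "\<And>t. t > s \<Longrightarrow> x + t *\<^sub>R d \<notin> K"
      using exit_point[of d] d by auto
    obtain r where r: "r > 0" "x - r *\<^sub>R d \<in> K" "\<And>t. t > r \<Longrightarrow> x - t *\<^sub>R d \<notin> K"
      using exit_point[of "-d"] d by auto
    \<comment> \<open>Since \<open>x\<close> lies strictly between the exit point and a further point of \<open>K\<close>, a segment around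
      the exit point shrinks to a parallel segment around \<open>x\<close>.\<close>
    have dirs: "two_sided_directions K (x + a *\<^sub>R d') \<subseteq> two_sided_directions K x"
      if "a > 0" "b > 0" "x - b *\<^sub>R d' \<in> K" for a b d'
    proof
      fix e assume "e \<in> two_sided_directions K (x + a *\<^sub>R d')"
      then obtain t where t: "t > 0" "x + a *\<^sub>R d' + t *\<^sub>R e \<in> K" "x + a *\<^sub>R d' - t *\<^sub>R e \<in> K"
        by (auto simp: two_sided_directions_def)
      define l where "l = b / (a + b)"
      have l: "0 < l" "0 \<le> l" "0 \<le> 1 - l" "l + (1 - l) = 1"
        using that by (simp_all add: l_def)
      have "l * (a + b) = b" using that by (simp add: l_def)
      then have la: "l * a = (1 - l) * b" by (simp add: algebra_simps)
      have mix: "l *\<^sub>R (x + a *\<^sub>R d' + y) + (1 - l) *\<^sub>R (x - b *\<^sub>R d') = x + l *\<^sub>R y" for y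
      proof -
        have "l *\<^sub>R (x + a *\<^sub>R d' + y) + (1 - l) *\<^sub>R (x - b *\<^sub>R d')
          = x + l *\<^sub>R y + (l * a - (1 - l) * b) *\<^sub>R d'" by (simp add: algebra_simps)
        then show ?thesis using la by simp
      qed
      have "x + (l * t) *\<^sub>R e \<in> K" "x - (l * t) *\<^sub>R e \<in> K"
        using convexD[OF K(1) t(2) that(3) l(2-4)] convexD[OF K(1) t(3) that(3) l(2-4)]
          mix[of "t *\<^sub>R e"] mix[of "- t *\<^sub>R e"] by auto
      then show "e \<in> two_sided_directions K x"
        using t(1) l(1) by (auto simp: two_sided_directions_def intro!: exI[of _ "l * t"])
    qed
    have d_x: "d \<in> two_sided_directions K x"
      using d by (auto simp: two_sided_directions_def intro!: exI[of _ 1])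
    have "d \<notin> two_sided_directions K (x + s *\<^sub>R d)"
    proof
      assume "d \<in> two_sided_directions K (x + s *\<^sub>R d)"
      then obtain t where "t > 0" "x + (s + t) *\<^sub>R d \<in> K"
        by (auto simp: two_sided_directions_def algebra_simps)
      then show False using s(3)[of "s + t"] by simp
    qed
    then have sub1: "two_sided_directions K (x + s *\<^sub>R d) \<subset> two_sided_directions K x"
      using dirs[OF s(1) r(1,2)] d_x by blast
    have "d \<notin> two_sided_directions K (x - r *\<^sub>R d)"
    proof
      assume "d \<in> two_sided_directions K (x - r *\<^sub>R d)"
      then obtain t where "t > 0" "x - (r + t) *\<^sub>R d \<in> K"
        by (auto simp: two_sided_directions_def algebra_simps)
      then show False using r(3)[of "r + t"] by simp
    qed
    then have sub2: "two_sided_directions K (x - r *\<^sub>R d) \<subset> two_sided_directions K x"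
      using dirs[OF r(1) s(1), of "-d"] s(2) d_x by auto
    note sp = subspace_two_sided_directions[OF K(1)]
    have ends: "x + s *\<^sub>R d \<in> convex hull {e. e extreme_point_of K}"
      "x - r *\<^sub>R d \<in> convex hull {e. e extreme_point_of K}"
      using less.hyps dim_psubset_finite_dimensional[OF fd sp sp sub1]
        dim_psubset_finite_dimensional[OF fd sp sp sub2] s(2) r(2) less.prems by auto
    define l where "l = r / (s + r)"
    have l: "0 \<le> l" "0 \<le> 1 - l" "l + (1 - l) = 1"
      using s(1) r(1) by (simp_all add: l_def)
    have "l * (s + r) = r" using s(1) r(1) by (simp add: l_def)
    then have lz: "l * s - (1 - l) * r = 0" by (simp add: algebra_simps)
    have "l *\<^sub>R (x + s *\<^sub>R d) + (1 - l) *\<^sub>R (x - r *\<^sub>R d) = x + (l * s - (1 - l) * r) *\<^sub>R d"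
      by (simp add: algebra_simps)
    then have "l *\<^sub>R (x + s *\<^sub>R d) + (1 - l) *\<^sub>R (x - r *\<^sub>R d) = x" using lz by simp
    then show ?thesis
      using convexD[OF convex_convex_hull ends l] by simp
  qed
qed

section \<open>Birkhoff-James orthogonality and one-sided derivatives of the norm\<close>

text \<open>The norm is convex along a line, so a local minimum is a global one.\<close>

lemma bj_orthogonal_local:
  fixes x y :: "'a::real_normed_vector"
  assumes "d > 0" and loc: "\<And>c. \<bar>c\<bar> < d \<Longrightarrow> norm x \<le> norm (x + c *\<^sub>R y)"
  shows "x \<bottom>\<^sub>B y"
  unfolding bj_orthogonal_def
proof
  fix c :: real
  define s where "s = min 1 (d / (\<bar>c\<bar> + 1))"
  have s: "0 < s" "s \<le> 1" using assms(1) by (auto simp: s_def)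
  have "s * \<bar>c\<bar> \<le> d / (\<bar>c\<bar> + 1) * \<bar>c\<bar>" by (intro mult_right_mono) (auto simp: s_def)
  also have "\<dots> < d" using assms(1) by (simp add: field_simps)
  finally have "\<bar>s * c\<bar> < d" using s(1) by (simp add: abs_mult)
  then have "norm x \<le> norm (x + (s * c) *\<^sub>R y)" by (rule loc)
  also have "x + (s * c) *\<^sub>R y = (1 - s) *\<^sub>R x + s *\<^sub>R (x + c *\<^sub>R y)" by (simp add: algebra_simps)
  also have "norm \<dots> \<le> (1 - s) * norm x + s * norm (x + c *\<^sub>R y)"
    using norm_triangle_ineq[of "(1 - s) *\<^sub>R x" "s *\<^sub>R (x + c *\<^sub>R y)"] s by simp
  finally have "s * norm x \<le> s * norm (x + c *\<^sub>R y)" by (simp add: algebra_simps)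
  then show "norm x \<le> norm (x + c *\<^sub>R y)" using s(1) by simp
qed

text \<open>
  Here \<open>p\<close> and \<open>q\<close> are lower bounds for the right derivatives at \<open>x\<close> in the directions \<open>y\<close> and
  \<open>- y\<close>. For small \<open>l\<close>, the vector \<open>x + l *\<^sub>R (y - c *\<^sub>R x)\<close> is a positive multiple of a point
  \<open>x + s *\<^sub>R y\<close>, whose norm these slopes bound from below.
\<close>

lemma bj_orthogonal_between_one_sided_slopes:
  fixes x y :: "'a::real_normed_vector"
  assumes "norm x = 1" "- q \<le> c" "c \<le> p"
    and p: "\<And>t. t > 0 \<Longrightarrow> 1 + t * p \<le> norm (x + t *\<^sub>R y)"
    and q: "\<And>t. t > 0 \<Longrightarrow> 1 + t * q \<le> norm (x - t *\<^sub>R y)"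
  shows "x \<bottom>\<^sub>B y - c *\<^sub>R x"
proof (rule bj_orthogonal_local)
  show "1 / (\<bar>c\<bar> + 1) > 0" by simp
  fix l :: real assume "\<bar>l\<bar> < 1 / (\<bar>c\<bar> + 1)"
  then have "\<bar>l\<bar> * (\<bar>c\<bar> + 1) < 1" by (simp add: field_simps)
  then have "\<bar>l * c\<bar> < 1" by (simp add: abs_mult algebra_simps)
  then have g: "1 - l * c > 0" by linarith
  define s where "s = l / (1 - l * c)"
  have s: "(1 - l * c) * s = l" using g by (simp add: s_def)
  have "x + l *\<^sub>R (y - c *\<^sub>R x) = (1 - l * c) *\<^sub>R x + l *\<^sub>R y" by (simp add: algebra_simps)
  also have "\<dots> = (1 - l * c) *\<^sub>R (x + s *\<^sub>R y)" using s by (simp add: scaleR_add_right)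
  finally have eq: "norm (x + l *\<^sub>R (y - c *\<^sub>R x)) = (1 - l * c) * norm (x + s *\<^sub>R y)"
    using g by simp
  have "1 \<le> (1 - l * c) * norm (x + s *\<^sub>R y)"
  proof (cases "l = 0")
    case True
    then show ?thesis using assms(1) by (simp add: s_def)
  next
    case False
    show ?thesis
    proof (cases "l > 0")
      case True
      then have "s > 0" using g by (simp add: s_def)
      have "l * c \<le> l * p" using True assms(3) by simp
      then have "1 \<le> (1 - l * c) + l * p" by simp
      also have "\<dots> = (1 - l * c) * (1 + s * p)" using s by (simp add: distrib_left mult.assoc[symmetric])
      also have "\<dots> \<le> (1 - l * c) * norm (x + s *\<^sub>R y)"
        using g p[OF \<open>s > 0\<close>] by simp
      finally show ?thesis .
    next
      case neg: False
      with False have "l < 0" by simp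
      then have "- s > 0" using g by (simp add: s_def divide_neg_pos)
      have "l * c \<le> l * (- q)" using \<open>l < 0\<close> assms(2) by (intro mult_left_mono_neg) auto
      then have "1 \<le> (1 - l * c) + (- l) * q" by simp
      also have "\<dots> = (1 - l * c) * (1 + (- s) * q)"
        using s by (simp add: right_diff_distrib mult.assoc[symmetric])
      also have "\<dots> \<le> (1 - l * c) * norm (x + s *\<^sub>R y)"
        using g q[OF \<open>- s > 0\<close>] by simp
      finally show ?thesis .
    qed
  qed
  then show "norm x \<le> norm (x + l *\<^sub>R (y - c *\<^sub>R x))" using eq assms(1) by simp
qed

lemma norm_difference_quotient_mono:
  fixes x y :: "'a::real_normed_vector"
  assumes "0 < s" "s \<le> t"
  shows "(norm (x + s *\<^sub>R y) - norm x) / s \<le> (norm (x + t *\<^sub>R y) - norm x) / t"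
proof -
  define l where "l = s / t"
  have l: "0 < l" "l \<le> 1" "l * t = s" using assms by (auto simp: l_def)
  have "x + s *\<^sub>R y = (1 - l) *\<^sub>R x + l *\<^sub>R (x + t *\<^sub>R y)"
    using l by (simp add: algebra_simps)
  also have "norm \<dots> \<le> (1 - l) * norm x + l * norm (x + t *\<^sub>R y)"
    using norm_triangle_ineq[of "(1 - l) *\<^sub>R x" "l *\<^sub>R (x + t *\<^sub>R y)"] l by simp
  finally have "norm (x + s *\<^sub>R y) - norm x \<le> l * (norm (x + t *\<^sub>R y) - norm x)"
    by (simp add: algebra_simps)
  then show ?thesis using assms by (simp add: l_def field_simps)
qed

text \<open>
  The difference quotients decrease as the step size does, so their limit exists and is also a lower
  bound for all of them. Both facts are recorded: the bound yields orthogonality, and the limit, along a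
  concrete sequence, is what passes to subsequences in a compactness argument.
\<close>

lemma norm_right_derivative_exists:
  fixes x y :: "'a::real_normed_vector"
  obtains p where "\<And>t. t > 0 \<Longrightarrow> norm x + t * p \<le> norm (x + t *\<^sub>R y)"
    and "(\<lambda>m. (norm (x + inverse (Suc m) *\<^sub>R y) - norm x) / inverse (Suc m)) \<longlonglongrightarrow> p"
proof -
  define f where "f t = (norm (x + t *\<^sub>R y) - norm x) / t" for t
  define q where "q m = f (inverse (Suc m))" for m :: nat
  have mono: "f s \<le> f t" if "0 < s" "s \<le> t" for s t
    unfolding f_def by (rule norm_difference_quotient_mono[OF that])
  have "- norm y \<le> f t" if "t > 0" for t
  proof -
    have "norm x \<le> norm (x + t *\<^sub>R y) + t * norm y"
      using norm_triangle_ineq4[of "x + t *\<^sub>R y" "t *\<^sub>R y"] that by simp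
    then show ?thesis using that by (simp add: f_def field_simps)
  qed
  then have "\<And>m. - norm y \<le> q m" by (simp add: q_def)
  moreover have "decseq q"
    unfolding decseq_def q_def by (auto intro!: mono le_imp_inverse_le)
  ultimately obtain p where p: "q \<longlonglongrightarrow> p" "\<And>m. p \<le> q m"
    using decseq_convergent[of q "- norm y"] by metis
  have "norm x + t * p \<le> norm (x + t *\<^sub>R y)" if t: "t > 0" for t
  proof -
    obtain m where "inverse (real (Suc m)) < t" using reals_Archimedean[OF t] by blast
    then have "q m \<le> f t" unfolding q_def by (intro mono) auto
    then have "p \<le> f t" using p(2)[of m] by linarith
    then show ?thesis using t by (simp add: f_def field_simps)
  qed
  moreover have "q = (\<lambda>m. (norm (x + inverse (Suc m) *\<^sub>R y) - norm x) / inverse (Suc m))"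
    by (rule ext) (simp only: q_def f_def)
  ultimately show thesis using that p(1) by blast
qed

section \<open>Extreme points of polytopes are corners\<close>

lemma convex_hull_remove_extreme_point:
  assumes "x extreme_point_of (convex hull E)"
  shows "x \<notin> convex hull (E - {x})"
proof
  assume "x \<in> convex hull (E - {x})"
  have "convex (convex hull E - {x})"
    using assms by (simp add: extreme_point_of_stillconvex convex_convex_hull)
  moreover have "E - {x} \<subseteq> convex hull E - {x}" using hull_subset[of E convex] by blast
  ultimately have "convex hull (E - {x}) \<subseteq> convex hull E - {x}" by (rule hull_minimal[rotated])
  then show False using \<open>x \<in> convex hull (E - {x})\<close> by blast
qed

text \<open>
  The points \<open>x + t *\<^sub>R y\<close>, scaled back to the ball, lie on segments from \<open>x\<close> to the hull of the
  other vertices. To first order in \<open>t\<close> the scaling replaces \<open>y\<close> by \<open>y - p *\<^sub>R x\<close>, so this vector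
  is a limit of elements of the cone at \<open>x\<close> generated by the other vertices. The cone is closed because
  that hull is compact and misses \<open>x\<close>, which keeps the factors \<open>r\<close> bounded.
\<close>

lemma tangent_direction_in_cone:
  fixes x y :: "'a::real_normed_vector" and E :: "'a set"
  assumes E: "finite E" "cball 0 1 = convex hull E" "E - {x} \<noteq> {}"
    and x: "x extreme_point_of cball 0 1" "norm x = 1"
    and lim: "(\<lambda>m. (norm (x + inverse (Suc m) *\<^sub>R y) - norm x) / inverse (Suc m)) \<longlonglongrightarrow> p"
  obtains r k where "r \<ge> 0" "k \<in> convex hull (E - {x})" "y - p *\<^sub>R x = r *\<^sub>R (k - x)"
proof -
  let ?K = "convex hull (E - {x})"
  have cK: "compact ?K" using E(1) by (simp add: finite_imp_compact_convex_hull)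
  have xK: "x \<notin> ?K" using convex_hull_remove_extreme_point x(1) E(2) by metis
  have xE: "x \<in> E" using x(1) E(2) extreme_point_of_convex_hull by metis
  define t where "t m = inverse (real (Suc m))" for m
  define q where "q m = (norm (x + t m *\<^sub>R y) - norm x) / t m" for m
  have t: "t m > 0" for m by (simp add: t_def)
  have "q = (\<lambda>m. (norm (x + inverse (Suc m) *\<^sub>R y) - norm x) / inverse (Suc m))"
    by (rule ext) (simp only: q_def t_def)
  with lim have q: "q \<longlonglongrightarrow> p" by simp
  have "\<exists>r\<ge>0. \<exists>k\<in>?K. y - q m *\<^sub>R x = r *\<^sub>R (k - x)" for m
  proof -
    define n where "n = norm (x + t m *\<^sub>R y)"
    have nq: "n = 1 + t m * q m" using t[of m] x(2) by (simp add: q_def n_def)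
    \<comment> \<open>The case \<open>n = 0\<close> has to be kept, because the step \<open>t m\<close> need not be small.\<close>
    obtain b where b: "b \<in> cball 0 1" "x + t m *\<^sub>R y = n *\<^sub>R b"
    proof (cases "n = 0")
      case True
      then show thesis using that[of 0] by (auto simp: n_def)
    next
      case False
      then show thesis using that[of "(x + t m *\<^sub>R y) /\<^sub>R n"] by (auto simp: n_def)
    qed
    have "b \<in> convex hull (insert x (E - {x}))" using b(1) E(2) xE by (simp add: insert_absorb)
    then obtain u v k where uv: "u \<ge> 0" "v \<ge> 0" "u + v = 1" "k \<in> ?K" "b = u *\<^sub>R x + v *\<^sub>R k"
      using convex_hull_insert[OF E(3), of x] by auto
    have "u = 1 - v" using uv(3) by simp
    with uv(5) have "b = (1 - v) *\<^sub>R x + v *\<^sub>R k" by simp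
    then have bx: "b - x = v *\<^sub>R (k - x)" by (simp add: algebra_simps)
    have "t m *\<^sub>R (y - q m *\<^sub>R x) = n *\<^sub>R (b - x)"
    proof -
      have "t m *\<^sub>R (y - q m *\<^sub>R x) = (x + t m *\<^sub>R y) - n *\<^sub>R x"
        by (simp add: nq algebra_simps)
      then show ?thesis using b(2) by (simp add: algebra_simps)
    qed
    then have "t m *\<^sub>R (y - q m *\<^sub>R x) = t m *\<^sub>R ((n * v / t m) *\<^sub>R (k - x))"
      using bx t[of m] by simp
    then have "y - q m *\<^sub>R x = (n * v / t m) *\<^sub>R (k - x)"
      using t[of m] by (metis less_numeral_extra(3) scaleR_cancel_left)
    moreover have "n * v / t m \<ge> 0" using uv t[of m] by (simp add: n_def)
    ultimately show ?thesis using uv(4) by blast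
  qed
  then obtain r k where rk: "\<And>m. r m \<ge> 0" "\<And>m. k m \<in> ?K" "\<And>m. y - q m *\<^sub>R x = r m *\<^sub>R (k m - x)"
    by metis
  obtain k0 h where k0: "k0 \<in> ?K" "strict_mono h" "(k \<circ> h) \<longlonglongrightarrow> k0"
    using cK rk(2) unfolding compact_def by metis
  have k0x: "norm (k0 - x) \<noteq> 0" using k0(1) xK by auto
  have lk: "(\<lambda>m. k (h m) - x) \<longlonglongrightarrow> k0 - x"
    using k0(3) by (intro tendsto_intros) (simp add: o_def)
  have lq: "(\<lambda>m. y - q (h m) *\<^sub>R x) \<longlonglongrightarrow> y - p *\<^sub>R x"
    using LIMSEQ_subseq_LIMSEQ[OF q k0(2)] by (intro tendsto_intros) (simp add: o_def)
  \<comment> \<open>The factor is determined by the two vectors, so it converges along the subsequence as well.\<close>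
  have rn: "r m = norm (y - q m *\<^sub>R x) / norm (k m - x)" for m
  proof -
    have "norm (k m - x) \<noteq> 0" using rk(2)[of m] xK by auto
    then show ?thesis using rk(1)[of m] rk(3)[of m] by simp
  qed
  define r0 where "r0 = norm (y - p *\<^sub>R x) / norm (k0 - x)"
  have lr: "(\<lambda>m. r (h m)) \<longlonglongrightarrow> r0"
    unfolding rn r0_def by (intro tendsto_intros lq lk k0x)
  have "(\<lambda>m. y - q (h m) *\<^sub>R x) \<longlonglongrightarrow> r0 *\<^sub>R (k0 - x)"
    unfolding rk(3) by (intro tendsto_intros lr lk)
  then have "y - p *\<^sub>R x = r0 *\<^sub>R (k0 - x)" using lq LIMSEQ_unique by blast
  moreover have "r0 \<ge> 0" by (simp add: r0_def)
  ultimately show thesis using that k0(1) by blast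
qed

text \<open>
  The two shifts are the one-sided derivatives of the norm. If they coincided, \<open>y - p *\<^sub>R x\<close> and its
  negative would both lie in the cone at the vertex \<open>x\<close>, which would make \<open>x\<close> a convex combination of
  other points of the polytope.
\<close>

lemma extreme_point_two_orthogonal_shifts:
  fixes x y :: "'a::real_normed_vector" and E :: "'a set"
  assumes E: "finite E" "cball 0 1 = convex hull E"
    and x: "x extreme_point_of cball 0 1" "norm x = 1"
    and y: "y \<notin> span {x}"
  obtains c d where "c \<noteq> d" "x \<bottom>\<^sub>B y - c *\<^sub>R x" "x \<bottom>\<^sub>B y - d *\<^sub>R x"
proof -
  have ne: "E - {x} \<noteq> {}"
  proof
    assume "E - {x} = {}"
    then have "convex hull E \<subseteq> {x}" by (intro hull_minimal) auto
    then have "0 = x" using E(2)[symmetric] by auto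
    then show False using x(2) by simp
  qed
  obtain p where p: "\<And>t. t > 0 \<Longrightarrow> norm x + t * p \<le> norm (x + t *\<^sub>R y)"
    "(\<lambda>m. (norm (x + inverse (Suc m) *\<^sub>R y) - norm x) / inverse (Suc m)) \<longlonglongrightarrow> p"
    using norm_right_derivative_exists[of x y] by blast
  obtain q where q: "\<And>t. t > 0 \<Longrightarrow> norm x + t * q \<le> norm (x + t *\<^sub>R (-y))"
    "(\<lambda>m. (norm (x + inverse (Suc m) *\<^sub>R (-y)) - norm x) / inverse (Suc m)) \<longlonglongrightarrow> q"
    using norm_right_derivative_exists[of x "-y"] by blast
  let ?a = "\<lambda>m. (norm (x + inverse (Suc m) *\<^sub>R y) - norm x) / inverse (real (Suc m))"
  let ?b = "\<lambda>m. (norm (x + inverse (Suc m) *\<^sub>R (-y)) - norm x) / inverse (real (Suc m))"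
  have "0 \<le> p + q"
  proof (rule LIMSEQ_le_const[OF tendsto_add[OF p(2) q(2)]], intro exI[of _ 0] allI impI)
    fix m
    define s where "s = inverse (real (Suc m))"
    have "2 * norm x = norm ((x + s *\<^sub>R y) + (x + s *\<^sub>R (-y)))"
      by (simp flip: scaleR_2)
    also have "\<dots> \<le> norm (x + s *\<^sub>R y) + norm (x + s *\<^sub>R (-y))" by (rule norm_triangle_ineq)
    finally have "0 \<le> ((norm (x + s *\<^sub>R y) - norm x) + (norm (x + s *\<^sub>R (-y)) - norm x)) / s"
      by (simp add: s_def)
    then show "0 \<le> ?a m + ?b m" by (simp only: s_def add_divide_distrib)
  qed
  moreover have "p + q \<noteq> 0"
  proof
    assume "p + q = 0"
    then have qp: "q = - p" by simp
    obtain r k where rk: "r \<ge> 0" "k \<in> convex hull (E - {x})" "y - p *\<^sub>R x = r *\<^sub>R (k - x)"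
      using tangent_direction_in_cone[OF E ne x p(2)] by blast
    obtain s l where sl: "s \<ge> 0" "l \<in> convex hull (E - {x})" "- y - q *\<^sub>R x = s *\<^sub>R (l - x)"
      using tangent_direction_in_cone[OF E ne x q(2)] by blast
    have yx: "y - p *\<^sub>R x \<noteq> 0"
    proof
      assume "y - p *\<^sub>R x = 0"
      then have "y = p *\<^sub>R x" by simp
      then show False using y by (simp add: span_breakdown_eq)
    qed
    have r: "r > 0" using rk(1,3) yx by (cases "r = 0") auto
    have "r *\<^sub>R (k - x) + s *\<^sub>R (l - x) = 0"
      by (simp add: rk(3)[symmetric] sl(3)[symmetric] qp)
    then have "(r + s) *\<^sub>R x = r *\<^sub>R k + s *\<^sub>R l" by (simp add: algebra_simps)
    then have "(1 / (r + s)) *\<^sub>R ((r + s) *\<^sub>R x) = (1 / (r + s)) *\<^sub>R (r *\<^sub>R k + s *\<^sub>R l)"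
      by simp
    then have "x = (r / (r + s)) *\<^sub>R k + (s / (r + s)) *\<^sub>R l"
      using r sl(1) by (simp add: scaleR_add_right)
    moreover have "(r / (r + s)) *\<^sub>R k + (s / (r + s)) *\<^sub>R l \<in> convex hull (E - {x})"
      using r sl(1) by (intro convexD[OF convex_convex_hull rk(2) sl(2)])
        (auto simp: add_divide_distrib[symmetric])
    ultimately show False using convex_hull_remove_extreme_point x(1) E(2) by metis
  qed
  ultimately have "- q < p" by linarith
  have bj: "x \<bottom>\<^sub>B y - c *\<^sub>R x" if "- q \<le> c" "c \<le> p" for c
    by (rule bj_orthogonal_between_one_sided_slopes[OF x(2) that]) (use p(1) q(1) x(2) in auto)
  show thesis using that[of p "-q"] bj[of p] bj[of "-q"] \<open>- q < p\<close> by auto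
qed

section \<open>Operators preserving orthogonality at an extreme point\<close>

text \<open>
  A functional that supports the ball at \<open>w\<close> is constant on the segment from \<open>w - v\<close> to \<open>w + v\<close>,
  so it vanishes at \<open>v\<close>. In terms of the norm: were \<open>c\<close> nonzero, a small step \<open>l\<close> with the sign of
  \<open>c\<close> would lead to \<open>(1 - l * c) *\<^sub>R (w + s *\<^sub>R v)\<close>, a point of norm less than one.
\<close>

lemma two_sided_direction_unique_orthogonal_shift:
  fixes w v :: "'a::real_normed_vector"
  assumes w: "norm w = 1" and v: "norm (w + v) \<le> 1" "norm (w - v) \<le> 1"
    and bj: "w \<bottom>\<^sub>B v - c *\<^sub>R w"
  shows "c = 0"
proof (rule ccontr)
  assume "c \<noteq> 0"
  \<comment> \<open>Any step of the sign of \<open>c\<close> works for which \<open>\<bar>l\<bar> \<le> 1 - l * c\<close>.\<close>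
  define l where "l = sgn c / (\<bar>c\<bar> + 1) / 2"
  have lc: "0 < l * c" "l * c < 1/2" and l: "\<bar>l\<bar> \<le> 1/2"
    using \<open>c \<noteq> 0\<close> by (auto simp: l_def sgn_if field_simps)
  define s where "s = l / (1 - l * c)"
  have s: "\<bar>s\<bar> \<le> 1" "(1 - l * c) * s = l"
    using lc l by (auto simp: s_def abs_divide divide_simps)
  have "w + s *\<^sub>R v \<in> cball 0 1"
    by (rule convex_midsegment_mem[where t = 1]) (use v s in auto)
  then have n: "norm (w + s *\<^sub>R v) \<le> 1" by simp
  have "w + l *\<^sub>R (v - c *\<^sub>R w) = (1 - l * c) *\<^sub>R w + l *\<^sub>R v" by (simp add: algebra_simps)
  also have "\<dots> = (1 - l * c) *\<^sub>R (w + s *\<^sub>R v)" using s(2) by (simp add: scaleR_add_right)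
  finally have "norm (w + l *\<^sub>R (v - c *\<^sub>R w)) \<le> 1 - l * c"
    using n lc by (simp add: mult_left_le)
  then show False using bj w lc(1) unfolding bj_orthogonal_def by (smt (verit))
qed

lemma bj_orthogonal_scaleR_left:
  fixes x y :: "'a::real_normed_vector"
  assumes "a > 0" "a *\<^sub>R x \<bottom>\<^sub>B y"
  shows "x \<bottom>\<^sub>B y"
  unfolding bj_orthogonal_def
proof
  fix c
  have "norm (a *\<^sub>R x) \<le> norm (a *\<^sub>R x + (a * c) *\<^sub>R y)"
    using assms(2) unfolding bj_orthogonal_def by blast
  also have "a *\<^sub>R x + (a * c) *\<^sub>R y = a *\<^sub>R (x + c *\<^sub>R y)" by (simp add: algebra_simps)
  finally show "norm x \<le> norm (x + c *\<^sub>R y)" using assms(1) by simp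
qed

lemma linear_inj_imp_surj_equal_dim:
  fixes T :: "'a::real_vector \<Rightarrow> 'b::real_vector"
  assumes "finite_dimensional TYPE('b)" "linear T" "inj T"
    and dim: "dim (UNIV :: 'a set) = dim (UNIV :: 'b set)"
  shows "surj T"
proof (rule ccontr)
  assume "\<not> surj T"
  then have "range T \<subset> UNIV" by auto
  then have "dim (range T) < dim (UNIV :: 'b set)"
    using dim_psubset_finite_dimensional[OF assms(1)] assms(2)
    by (simp add: linear_subspace_image)
  moreover have "dim (range T) = dim (UNIV :: 'a set)"
  proof -
    obtain B :: "'a set" where B: "independent B" "UNIV \<subseteq> span B" "card B = dim (UNIV :: 'a set)"
      using basis_exists by blast
    have "independent (T ` B)" "card (T ` B) = card B"
      using B(1) assms(2,3) by (auto simp: linear_independent_injective_image card_image inj_on_def inj_def)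
    moreover have "span (T ` B) = range T"
      using B(2) assms(2) by (simp add: linear_span_image top.extremum_unique)
    ultimately show ?thesis using B(3) dim_eq_card_independent[of "T ` B"] dim_span[of "T ` B"] by simp
  qed
  ultimately show False using dim by simp
qed

lemma norm_extreme_point_of_unit_ball:
  fixes x :: "'a::real_normed_vector"
  assumes "x extreme_point_of cball 0 1" "x \<noteq> 0"
  shows "norm x = 1"
proof (rule ccontr)
  assume "norm x \<noteq> 1"
  then have "norm x < 1" using assms(1) by (simp add: extreme_point_of_def)
  then have "x \<in> open_segment 0 (x /\<^sub>R norm x)"
    using assms(2) by (auto simp: in_segment intro!: exI[of _ "norm x"])
  then show False using assms by (auto simp: extreme_point_of_def)
qed

theorem corollary2p10:
  fixes T :: "'a::banach \<Rightarrow> 'b::banach" and x :: 'a and n :: nat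
  assumes "polyhedral TYPE('a)" and "dim (UNIV :: 'a set) = n"
    and "polyhedral TYPE('b)" and "dim (UNIV :: 'b set) = n"
    and "linear T"
    and "x extreme_point_of cball 0 1"
    and "preserves_bj_orthogonality_at T x"
  shows "\<exists>(c :: real) e. e extreme_point_of cball 0 1 \<and> T x = c *\<^sub>R e"
proof (cases "T x = 0")
  case True
  have "0 \<in> convex hull {e :: 'b. e extreme_point_of cball 0 1}"
    using assms(3) by (intro finite_dimensional_convex_hull_extreme_points) (auto simp: polyhedral_def)
  then obtain e :: 'b where "e extreme_point_of cball 0 1" by fastforce
  then show ?thesis using True by (intro exI[of _ "0::real"] exI[of _ e]) simp
next
  case False
  interpret T: linear T by (rule assms(5))
  define E where "E = {e :: 'a. e extreme_point_of cball 0 1}"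
  have E: "finite E" "cball 0 1 = convex hull E"
  proof -
    show "finite E" using assms(1) by (simp add: polyhedral_def E_def)
    have "convex hull E \<subseteq> cball 0 1"
      by (rule hull_minimal) (auto simp: E_def extreme_point_of_def)
    moreover have "cball 0 1 \<subseteq> convex hull E"
      using assms(1) unfolding E_def polyhedral_def
      by (blast intro: finite_dimensional_convex_hull_extreme_points convex_cball closed_cball bounded_cball)
    ultimately show "cball 0 1 = convex hull E" by blast
  qed
  have nx: "norm x = 1"
    using norm_extreme_point_of_unit_ball[OF assms(6)] False linear_0[OF assms(5)] by metis
  define a where "a = norm (T x)"
  define w where "w = T x /\<^sub>R a"
  have a: "a > 0" and Tx: "T x = a *\<^sub>R w" and w: "norm w = 1"
    using False by (auto simp: a_def w_def)
  have image_direction: "u \<in> span {x}" if "norm (w + T u) \<le> 1" "norm (w - T u) \<le> 1" for u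
  proof (rule ccontr)
    assume "u \<notin> span {x}"
    then obtain c d where cd: "c \<noteq> d" "x \<bottom>\<^sub>B u - c *\<^sub>R x" "x \<bottom>\<^sub>B u - d *\<^sub>R x"
      using extreme_point_two_orthogonal_shifts[OF E assms(6) nx] by blast
    have "c = 0" if "x \<bottom>\<^sub>B u - c *\<^sub>R x" for c
    proof -
      have "T x \<bottom>\<^sub>B T u - c *\<^sub>R T x"
        using assms(7) that unfolding preserves_bj_orthogonality_at_def
        by (metis T.diff T.scale)
      then have "w \<bottom>\<^sub>B T u - (c * a) *\<^sub>R w"
        using bj_orthogonal_scaleR_left[OF a] by (simp add: Tx)
      then have "c * a = 0"
        using two_sided_direction_unique_orthogonal_shift[OF w] \<open>norm (w + T u) \<le> 1\<close> \<open>norm (w - T u) \<le> 1\<close>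
        by blast
      then show ?thesis using a by simp
    qed
    then show False using cd by metis
  qed
  have "inj T"
    unfolding T.inj_iff_eq_0
  proof (intro allI impI)
    fix u assume "T u = 0"
    then have "u \<in> span {x}" using image_direction w by simp
    then obtain b where "u = b *\<^sub>R x" by (auto simp: span_singleton)
    then show "u = 0" using \<open>T u = 0\<close> False by (simp add: T.scale)
  qed
  then have surj: "surj T"
    using linear_inj_imp_surj_equal_dim assms(2-5) by (metis polyhedral_def)
  have "w extreme_point_of cball 0 1"
  proof (rule ccontr)
    assume "\<not> w extreme_point_of cball 0 1"
    then obtain v where v: "v \<noteq> 0" "w + v \<in> cball 0 1" "w - v \<in> cball 0 1"
      using two_sided_direction_of_not_extreme[of "cball 0 1" w] w by auto
    obtain u where u: "v = T u" using surj by (metis surjD)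
    have "u \<in> span {x}" using image_direction v u by simp
    then obtain b where "u = b *\<^sub>R x" by (auto simp: span_singleton)
    then have vw: "v = (b * a) *\<^sub>R w" by (simp add: u T.scale Tx)
    have "w + v = (1 + b * a) *\<^sub>R w" "w - v = (1 - b * a) *\<^sub>R w"
      by (simp_all add: vw algebra_simps)
    then have "\<bar>1 + b * a\<bar> \<le> 1" "\<bar>1 - b * a\<bar> \<le> 1" using v(2,3) w by auto
    then have "b * a = 0" by linarith
    then show False using v(1) vw by simp
  qed
  then show ?thesis using Tx by blast
qed

end
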